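(* For every integer $n\geq 1$, let \[ V_{n}(x):=\frac{2(n+1)}{\binom{2n}{n}x^{n}(1-2x)}\left(Q_{n}(-x)^2-Q_{n-1}(-x)Q_{n+1}(-x)\right). \] Then, as formal power series in $t$, \[ \sum_{n=1}^{\infty}V_{n}(x)t^{n}=\frac{-2t^2+2(2-3x)t-1+2x+(1-2x)\sqrt{1-4xt}}{2(t+x-1)^{2}}. \]
   Context: For each integer $m\geq 0$, $P_m(x),Q_m(x)\in\mathbb{Q}[x]$ denote the unique pair of polynomials with $\deg P_m\leq m$, $\deg Q_m\leq m$ satisfying $P_m(x)x^{m+1}+Q_m(x)(x+1)^{m+1}=1$. Here $\sqrt{1-4xt}$ denotes the power series in $t$ with constant term $1$ given by the binomial series. *)

theory Defs
  imports
    "HOL-Computational_Algebra.Computational_Algebra"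
    "HOL-Computational_Algebra.Field_as_Ring"
begin

definition bezout_pair :: "nat \<Rightarrow> rat poly \<times> rat poly \<Rightarrow> bool" where
  "bezout_pair m = (\<lambda>(p, q). degree p \<le> m \<and> degree q \<le> m \<and>
     p * [:0, 1:] ^ (m + 1) + q * [:1, 1:] ^ (m + 1) = 1)"

lemma bezout_pair_ex1: "\<exists>!pq. bezout_pair m pq"
proof -
  define a :: "rat poly" where "a = [:0, 1:] ^ (m + 1)"
  define b :: "rat poly" where "b = [:1, 1:] ^ (m + 1)"
  have dega: "degree a = m + 1" and degb: "degree b = m + 1"
    unfolding a_def b_def by (subst degree_power_eq; simp)+
  have b0: "b \<noteq> 0" using degb by auto
  have "coprime [:0, 1 :: rat:] [:1, 1:]"
  proof (rule coprimeI)
    fix d :: "rat poly" assume "d dvd [:0, 1:]" "d dvd [:1, 1:]"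
    hence "d dvd [:1, 1:] - [:0, 1:]" by (rule dvd_diff[rotated])
    thus "is_unit d" by (simp add: one_pCons)
  qed
  hence cop: "coprime a b" unfolding a_def b_def
    by (simp only: coprime_power_left_iff coprime_power_right_iff simp_thms)
  have pair_iff: "bezout_pair m (p, q) \<longleftrightarrow> degree p \<le> m \<and> degree q \<le> m \<and> p * a + q * b = 1" for p q
    by (simp add: bezout_pair_def a_def b_def)
  obtain u v where uv: "u * a + v * b = 1"
    using cop by (metis bezout_coefficients_fst_snd coprime_iff_gcd_eq_1)
  define p where "p = u mod b"
  define q where "q = v + (u div b) * a"
  have "p * a + q * b = (u mod b + u div b * b) * a + v * b"
    unfolding p_def q_def by (simp only: algebra_simps)
  hence eq: "p * a + q * b = 1" using uv by simp
  have degp: "degree p \<le> m"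
    using degree_mod_less[OF b0, of u] degb unfolding p_def by auto
  have degq: "degree q \<le> m"
  proof (cases "q = 0")
    case False
    have "q * b = 1 - p * a" using eq by (simp add: algebra_simps)
    moreover have "degree (1 - p * a) \<le> m + (m + 1)"
      using degp dega degree_mult_le[of p a] by (intro degree_diff_le) auto
    ultimately have "degree q + degree b \<le> m + (m + 1)"
      using False b0 by (metis degree_mult_eq)
    thus ?thesis using degb by simp
  qed simp
  show ?thesis
  proof (rule ex1I[of _ "(p, q)"])
    show "bezout_pair m (p, q)" using eq degp degq by (simp add: pair_iff)
  next
    fix pq' assume A: "bezout_pair m pq'"
    obtain p' q' where pq': "pq' = (p', q')" by (cases pq')
    have B: "degree p' \<le> m" "p' * a + q' * b = 1" using A by (simp_all add: pq' pair_iff)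
    have D: "(p - p') * a = (q' - q) * b" using eq B(2) by (simp add: algebra_simps)
    hence "b dvd (p - p') * a" by simp
    hence dvd: "b dvd p - p'"
      using cop by (simp add: coprime_commute coprime_dvd_mult_left_iff)
    have "degree (p - p') < degree b"
      using degree_diff_le[OF degp B(1)] degb by simp
    hence "p = p'" using dvd dvd_imp_degree_le[of b "p - p'"] by fastforce
    moreover from this D b0 have "q = q'" by simp
    ultimately show "pq' = (p, q)" by (simp add: pq')
  qed
qed

definition bezout_polys :: "nat \<Rightarrow> rat poly \<times> rat poly" where
  "bezout_polys m = (THE pq. bezout_pair m pq)"

definition polyP :: "nat \<Rightarrow> rat poly" where "polyP m = fst (bezout_polys m)"

definition polyQ :: "nat \<Rightarrow> rat poly" where "polyQ m = snd (bezout_polys m)"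

lemma bezout_pair_polyP_polyQ: "bezout_pair m (polyP m, polyQ m)"
  using theI'[OF bezout_pair_ex1[of m]] by (simp add: polyP_def polyQ_def bezout_polys_def)

text \<open>The field \<open>\<rat>(x)\<close> is \<^typ>\<open>rat poly fract\<close>, with \<open>x\<close> as follows.\<close>

definition xvar :: "rat poly fract" where "xvar = to_fract [:0, 1:]"

definition polyQ_neg :: "nat \<Rightarrow> rat poly fract" where
  "polyQ_neg m = to_fract (pcompose (polyQ m) [:0, -1:])"

text \<open>Only meaningful for \<open>n \<ge> 1\<close>, because of the truncated subtraction.\<close>

definition ratV :: "nat \<Rightarrow> rat poly fract" where
  "ratV n = 2 * (of_nat n + 1) / (of_nat ((2 * n) choose n) * xvar ^ n * (1 - 2 * xvar)) *
         ((polyQ_neg n)\<^sup>2 - polyQ_neg (n - 1) * polyQ_neg (n + 1))"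

text \<open>Power series in \<open>t\<close> over \<open>\<rat>(x)\<close>; the square root is the binomial series
  \<open>(1 + z)\<^bsup>1/2\<^esup>\<close> at \<open>z = -4xt\<close>.\<close>

definition sqrt_series :: "rat poly fract fps" where
  "sqrt_series = fps_compose (fps_binomial (1 / 2)) (fps_const (- 4 * xvar) * fps_X)"

end

theory Submission
  imports Defs
begin

text \<open>
  The polynomial \<open>q\<^sub>n = Q\<^sub>n(-x)\<close> is the truncation of \<open>(1 - x)\<^bsup>-(n+1)\<^esup>\<close> at degree \<open>n\<close>, whence
  \<open>(1 - x) q\<^sub>n\<^sub>+\<^sub>1 = q\<^sub>n + b\<^sub>n\<^sub>+\<^sub>1 x\<^bsup>n+1\<^esup> (1 - 2x) / 2\<close>, where \<open>b\<^sub>n\<close> is the central binomial coefficient.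
  Eliminating \<open>q\<^sub>n\<^sub>-\<^sub>1\<close> and \<open>q\<^sub>n\<^sub>+\<^sub>1\<close> makes \<open>V\<^sub>n\<close> linear in \<open>q\<^sub>n\<close> with coefficients linear in \<open>n\<close>.
  Hence the generating function of \<open>V\<^sub>n\<close> is expressed through \<open>F = \<Sum> q\<^sub>n t\<^sup>n\<close>,
  \<open>B = \<Sum> b\<^sub>n x\<^sup>n t\<^sup>n = (1 - 4xt)\<^bsup>-1/2\<^esup>\<close> and their derivatives, while the recurrence gives
  \<open>2 (1 - x - t) F = 1 + (1 - 2x) B\<close>.
\<close>

section \<open>Central binomial coefficients\<close>

lemma central_binomial_Suc:
  "Suc n * ((2 * Suc n) choose (Suc n)) = 2 * (2 * n + 1) * ((2 * n) choose n)"
proof -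
  have "(2 * n + 1) choose (n + 1) = (2 * n + 1) choose n"
    using binomial_symmetric[of n "2 * n + 1"] by simp
  thus ?thesis
    using Suc_times_binomial_eq[of "2 * n + 1" n] Suc_times_binomial_eq[of "2 * n" n]
    by (simp add: algebra_simps)
qed

lemma double_binomial_odd: "2 * ((2 * n + 1) choose (n + 1)) = (2 * Suc n) choose (Suc n)"
  using binomial_symmetric[of n "2*n+1"] by simp

text \<open>Both sides satisfy the same first-order recurrence in \<open>n\<close>. This identifies
  the central binomial coefficients as the coefficients of the binomial series
  \<open>(1 - 4z)^(-1/2)\<close>.\<close>

lemma gbinomial_minus_half:
  "((- 1 / 2 :: 'a :: field_char_0) gchoose n) * (- 4) ^ n = of_nat ((2 * n) choose n)"
proof (induction n)
  case (Suc n)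
  have "of_nat (Suc n) * ((- 1 / 2 :: 'a) gchoose Suc n) = (- 1 / 2 - of_nat n) * ((- 1 / 2) gchoose n)"
    using gbinomial_mult_1[of "- 1 / 2 :: 'a" n] by (simp add: algebra_simps)
  hence "of_nat (Suc n) * (((- 1 / 2 :: 'a) gchoose Suc n) * (- 4) ^ Suc n)
      = (- 1 / 2 - of_nat n) * (- 4) * (((- 1 / 2) gchoose n) * (- 4) ^ n)"
    unfolding power_Suc by (simp only: mult.assoc[symmetric]) (simp only: mult_ac)
  also have "\<dots> = of_nat (2 * (2 * n + 1) * ((2 * n) choose n))"
    unfolding Suc.IH by (simp add: algebra_simps)
  also have "\<dots> = of_nat (Suc n) * of_nat ((2 * Suc n) choose (Suc n))"
    by (simp only: central_binomial_Suc[symmetric] of_nat_mult)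
  finally show ?case
    by (simp only: mult_cancel_left of_nat_eq_0_iff nat.distinct simp_thms)
qed simp

section \<open>The polynomials \<open>polyQ\<close> and their recurrence\<close>

text \<open>Multiplying the Bezout identity by the power series \<open>(1 + X)^(-(m+1))\<close>
  isolates \<open>polyQ m\<close>; the term with \<open>polyP m\<close> carries a factor
  \<open>X^(m+1)\<close> and so is invisible in degrees up to \<open>m\<close>.\<close>

lemma coeff_polyQ: "coeff (polyQ m) k = (if k \<le> m then (- 1) ^ k * of_nat ((m + k) choose k) else 0)"
proof (cases "k \<le> m")
  case False
  thus ?thesis using bezout_pair_polyP_polyQ[of m]
    by (auto simp: bezout_pair_def intro: coeff_eq_0)
next
  case True
  let ?B = "fps_binomial (- of_nat (m + 1)) :: rat fps"
  let ?P = "fps_of_poly (polyP m)" and ?Q = "fps_of_poly (polyQ m)"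
  have "polyP m * [:0, 1:] ^ (m + 1) + polyQ m * [:1, 1:] ^ (m + 1) = 1"
    using bezout_pair_polyP_polyQ[of m] by (simp add: bezout_pair_def)
  hence "fps_of_poly (polyP m * [:0, 1:] ^ (m + 1) + polyQ m * [:1, 1:] ^ (m + 1)) = 1"
    by simp
  hence eq: "?P * fps_X ^ (m + 1) + ?Q * (1 + fps_X) ^ (m + 1) = 1"
    by (simp only: fps_of_poly_add fps_of_poly_mult fps_of_poly_power fps_of_poly_pCons
        fps_of_poly_0 fps_const_0_eq_0 fps_const_1_eq_1 mult_zero_left add_0 add_0_right mult_1_left)
  have "?Q * ((1 + fps_X) ^ (m + 1) * ?B) =
      (?P * fps_X ^ (m + 1) + ?Q * (1 + fps_X) ^ (m + 1)) * ?B - (?P * ?B) * fps_X ^ (m + 1)"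
    by (simp only: distrib_right) (simp only: mult_ac add_diff_cancel_left')
  moreover have "(1 + fps_X) ^ (m + 1) * ?B = 1"
    by (simp only: fps_binomial_of_nat[symmetric] fps_binomial_add_mult[symmetric]) simp
  ultimately have "?Q = ?B - (?P * ?B) * fps_X ^ (m + 1)"
    by (simp only: eq mult_1_left mult_1_right)
  hence "fps_nth ?Q k = fps_nth ?B k"
    using True by (simp only: fps_sub_nth fps_X_power_mult_right_nth) simp
  also have "\<dots> = (- 1) ^ k * of_nat ((m + k) choose k)"
    using gbinomial_minus[of "of_nat (m + 1) :: rat" k]
    by (simp add: binomial_gbinomial algebra_simps)
  finally show ?thesis using True by simp
qed

lemma coeff_pcompose_neg: "coeff (pcompose p [:0, - 1 :: 'a :: comm_ring_1:]) k = (- 1) ^ k * coeff p k"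
  using coeff_pcompose_linear[of p "- 1" k] by simp

lemma to_fract_of_nat: "to_fract (of_nat n) = of_nat n"
  by (induction n) simp_all

lemma polyQ_neg_Suc:
  "(1 - xvar) * polyQ_neg (Suc m) =
     polyQ_neg m + of_nat ((2 * Suc m) choose (Suc m)) / 2 * xvar ^ Suc m * (1 - 2 * xvar)"
proof -
  let ?R = "\<lambda>m. pcompose (polyQ m) [:0, - 1:]"
  \<comment> \<open>Half of the central binomial coefficient of index \<open>m + 1\<close>, which
    keeps the identity integral while working with polynomials.\<close>
  let ?c = "(2 * m + 1) choose (m + 1)"
  have R: "coeff (?R m) k = (if k \<le> m then of_nat ((m + k) choose k) else 0)" for m k
    by (simp add: coeff_pcompose_neg coeff_polyQ flip: mult.assoc power_add mult_2)
  have "[:1, - 1:] * ?R (Suc m) = ?R m + of_nat ?c * ([:0, 1:] ^ Suc m * [:1, - 2:])"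
  proof (rule poly_eqI)
    fix k
    have c: "of_nat ?c = [:of_nat ?c :: rat:]" by (simp add: of_nat_poly)
    have x: "[:0, 1 :: rat:] ^ Suc m = monom 1 (Suc m)" by (simp only: monom_altdef smult_1_left)
    have l: "coeff ([:1, - 1:] * ?R (Suc m)) k
        = coeff (?R (Suc m)) k - (if k = 0 then 0 else coeff (?R (Suc m)) (k - 1))"
      by (cases k) simp_all
    have r: "coeff (of_nat ?c * ([:0, 1:] ^ Suc m * [:1, - 2:])) k =
        (if k < Suc m then 0 else of_nat ?c * coeff [:1, -2 :: rat:] (k - Suc m))"
      unfolding c x by (simp add: coeff_monom_mult del: mult_pCons_right binomial_Suc_Suc)
    have e1: "of_nat ((Suc m + Suc m) choose Suc m) = (2 * of_nat ?c :: rat)"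
      unfolding mult_2[symmetric] double_binomial_odd[symmetric]
      by (simp only: of_nat_mult of_nat_numeral)
    have e2: "(Suc m + m) choose m = ?c"
      using binomial_symmetric[of m "2 * m + 1"] by (simp add: mult_2)
    \<comment> \<open>Up to degree \<open>m\<close> the identity is Pascal's rule. The truncation
      shows only in degrees \<open>m + 1\<close> and \<open>m + 2\<close>, where the left side is
      \<open>?c\<close> and \<open>- 2 * ?c\<close>.\<close>
    consider "k = 0" | j where "k = Suc j" "j < m" | "k = Suc m" | "k = Suc (Suc m)" | "k > Suc (Suc m)"
      by (cases k) (auto, linarith)
    thus "coeff ([:1, - 1:] * ?R (Suc m)) k
        = coeff (?R m + of_nat ?c * ([:0, 1:] ^ Suc m * [:1, - 2:])) k"
    proof cases
      case 5
      thus ?thesis unfolding l coeff_add r R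
        by (auto simp: coeff_pCons split: nat.splits)
    next
      case 4
      thus ?thesis unfolding l coeff_add r R
        by (simp add: e1 del: binomial_Suc_Suc add_Suc add_Suc_right)
    next
      case 3
      thus ?thesis unfolding l coeff_add r R
        by (simp add: e1 e2 del: binomial_Suc_Suc add_Suc add_Suc_right)
    next
      case 2
      thus ?thesis unfolding l coeff_add r R by simp
    next
      case 1
      thus ?thesis unfolding l coeff_add r R by simp
    qed
  qed
  hence "to_fract ([:1, - 1:] * ?R (Suc m)) =
      to_fract (?R m + of_nat ?c * ([:0, 1:] ^ Suc m * [:1, - 2:]))" by simp
  moreover have "to_fract [:1, - 1:] = 1 - xvar"
    unfolding xvar_def by (simp flip: to_fract_1 to_fract_diff add: one_pCons)
  moreover have "to_fract [:1, - 2:] = 1 - 2 * xvar"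
  proof -
    have "[:1, - 2:] = 1 - ([:0, 1:] + [:0, 1 :: rat:])" by (simp add: one_pCons)
    thus ?thesis unfolding xvar_def mult_2 by (simp only: to_fract_1 to_fract_diff to_fract_add)
  qed
  moreover have "of_nat ((2 * Suc m) choose (Suc m)) = (2 * of_nat ?c :: rat poly fract)"
    by (simp only: double_binomial_odd[symmetric] of_nat_mult of_nat_numeral)
  moreover have "to_fract ([:0, 1:] ^ n) = xvar ^ n" for n
    unfolding xvar_def by (induction n) (simp_all del: mult_pCons_left)
  ultimately show ?thesis
    by (simp add: polyQ_neg_def to_fract_of_nat mult.assoc
        del: power_Suc binomial_Suc_Suc mult_pCons_left mult_pCons_right mult_Suc_right)
qed

lemma polyQ_neg_0: "polyQ_neg 0 = 1"
proof -
  have "pcompose (polyQ 0) [:0, - 1:] = 1"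
    by (rule poly_eqI) (simp add: coeff_pcompose_neg coeff_polyQ)
  thus ?thesis by (simp add: polyQ_neg_def)
qed

lemma xvar_neq: "xvar \<noteq> 0" "1 - xvar \<noteq> 0" "1 - 2 * xvar \<noteq> 0"
proof -
  have eqs: "xvar = to_fract [:0, 1:]" "1 - xvar = to_fract [:1, - 1:]"
    "1 - 2 * xvar = to_fract [:1, - 2:]"
    by (simp_all add: xvar_def mult_2 one_pCons flip: to_fract_1 to_fract_diff to_fract_add)
  show "xvar \<noteq> 0" "1 - xvar \<noteq> 0" "1 - 2 * xvar \<noteq> 0"
    unfolding eqs(2,3) unfolding eqs(1) to_fract_eq_0_iff by simp_all
qed

section \<open>Linearisation of \<open>ratV\<close>\<close>

lemma ratV_eq:
  assumes "n \<ge> 1"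
  shows "(1 - xvar) * ratV n =
    polyQ_neg n * ((of_nat n + 1) - 2 * (2 * of_nat n + 1) * xvar * (1 - xvar)) +
    (2 * of_nat n + 1) * of_nat ((2 * n) choose n) * xvar ^ Suc n * (1 - 2 * xvar)"
proof -
  obtain m where n: "n = Suc m" using assms by (cases n) auto
  define x where "x = xvar"
  define b :: "rat poly fract" where "b = of_nat ((2 * n) choose n)"
  define b' :: "rat poly fract" where "b' = of_nat ((2 * Suc n) choose (Suc n))"
  define N :: "rat poly fract" where "N = of_nat n"
  define q where "q = polyQ_neg n"
  define r where "r = polyQ_neg (n - 1)"
  define s where "s = polyQ_neg (n + 1)"
  define y where "y = x ^ n"
  have N: "N + 1 \<noteq> 0" unfolding N_def using of_nat_eq_0_iff[of "Suc n", where 'a = "rat poly fract"]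
    by (simp add: add.commute)
  have b: "b \<noteq> 0" by (simp add: b_def)
  have y: "y \<noteq> 0" using xvar_neq by (simp add: y_def x_def)
  have x: "1 - x \<noteq> 0" "1 - 2 * x \<noteq> 0" using xvar_neq by (simp_all add: x_def)
  have "of_nat (Suc n * ((2 * Suc n) choose (Suc n))) = (of_nat (2 * (2 * n + 1) * ((2 * n) choose n)) :: rat poly fract)"
    by (simp only: central_binomial_Suc)
  hence bb: "(N + 1) * b' = 2 * (2 * N + 1) * b"
    by (simp only: of_nat_mult b_def b'_def N_def of_nat_Suc of_nat_add of_nat_numeral of_nat_1 add.commute)
  have s: "2 * (1 - x) * s = 2 * q + b' * (x * y) * (1 - 2 * x)"
    using polyQ_neg_Suc[of n] by (simp add: s_def q_def b'_def x_def y_def field_simps del: binomial_Suc_Suc)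
  have r: "2 * r = 2 * (1 - x) * q - b * y * (1 - 2 * x)"
    using polyQ_neg_Suc[of m] by (simp add: n r_def q_def b_def x_def y_def field_simps del: binomial_Suc_Suc)
  have V: "ratV n * (b * y * (1 - 2 * x)) = 2 * (N + 1) * (q ^ 2 - r * s)"
    using b y x by (simp add: ratV_def b_def y_def x_def N_def q_def r_def s_def)
  \<comment> \<open>The factor \<open>2 * (1 - x)\<close> lets the recurrences for \<open>s\<close>
    and \<open>r\<close> be substituted without division.\<close>
  have "2 * (1 - x) * (ratV n * (b * y * (1 - 2 * x)))
     = (N + 1) * (4 * (1 - x) * q ^ 2 - (2 * r) * (2 * (1 - x) * s))"
    unfolding V by (simp add: algebra_simps)
  also have "\<dots> = 2 * (1 - x) * q * (N + 1) * (2 * q) - (2 * r) * (2 * q * (N + 1) + ((N + 1) * b') * (x * y) * (1 - 2 * x))"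
    unfolding s by (simp add: algebra_simps power2_eq_square)
  \<comment> \<open>The terms in \<open>q ^ 2\<close> without \<open>b\<close> cancel, and what is
    left is divisible by the denominator \<open>b * y * (1 - 2 * x)\<close> of
    \<open>ratV n\<close>.\<close>
  also have "\<dots> = 2 * (q * ((N + 1) - 2 * (2 * N + 1) * x * (1 - x)) + (2 * N + 1) * b * (x * y) * (1 - 2 * x)) * (b * y * (1 - 2 * x))"
    unfolding bb r by (simp add: algebra_simps power2_eq_square)
  finally have "2 * ((1 - x) * ratV n) * (b * y * (1 - 2 * x)) =
      2 * (q * ((N + 1) - 2 * (2 * N + 1) * x * (1 - x)) + (2 * N + 1) * b * (x * y) * (1 - 2 * x)) * (b * y * (1 - 2 * x))"
    by (simp only: mult.assoc)
  hence "(1 - x) * ratV n = q * ((N + 1) - 2 * (2 * N + 1) * x * (1 - x)) + (2 * N + 1) * b * (x * y) * (1 - 2 * x)"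
    using b y x by (simp only: mult_cancel_right mult_cancel_left mult_eq_0_iff zero_neq_numeral[symmetric] simp_thms)
  thus ?thesis by (simp add: q_def b_def x_def y_def N_def)
qed

section \<open>Generating functions in \<open>t\<close>\<close>

theorem theorem7p7:
  "Abs_fps (\<lambda>n. if n \<ge> 1 then ratV n else 0) =
    (- 2 * fps_X\<^sup>2 + 2 * (2 - 3 * fps_const xvar) * fps_X - 1 + 2 * fps_const xvar
       + (1 - 2 * fps_const xvar) * sqrt_series) /
    (2 * (fps_X + fps_const xvar - 1)\<^sup>2)"
proof -
  define x where "x = fps_const xvar"
  define t where "t = (fps_X :: rat poly fract fps)"
  define F where "F = Abs_fps polyQ_neg"
  define B where "B = Abs_fps (\<lambda>n. of_nat ((2 * n) choose n) * xvar ^ n)"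
  define W where "W = Abs_fps (\<lambda>n. if n \<ge> 1 then ratV n else 0)"
  have z0: "fps_nth (fps_const (- 4 * xvar) * fps_X) 0 = 0" by simp
  have B: "B = fps_compose (fps_binomial (- 1 / 2)) (fps_const (- 4 * xvar) * fps_X)"
  proof (rule fps_ext)
    fix n
    show "fps_nth B n = fps_nth (fps_compose (fps_binomial (- 1 / 2)) (fps_const (- 4 * xvar) * fps_X)) n"
      unfolding B_def fps_compose_linear fps_nth_Abs_fps fps_binomial_nth
        gbinomial_minus_half[symmetric] power_mult_distrib by (simp add: mult_ac)
  qed
  \<comment> \<open>Splitting the exponent as \<open>1 + (- 1 / 2)\<close> expresses the square root
    through \<open>B\<close>.\<close>
  have "fps_binomial (1 / 2 :: rat poly fract) = fps_binomial (1 + - 1 / 2)" by simp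
  also have "\<dots> = (1 + fps_X) * fps_binomial (- 1 / 2)"
    by (simp only: fps_binomial_add_mult fps_binomial_1)
  finally have "sqrt_series = fps_compose ((1 + fps_X) * fps_binomial (- 1 / 2)) (fps_const (- 4 * xvar) * fps_X)"
    unfolding sqrt_series_def by simp
  also have "\<dots> = (1 + fps_const (- 4 * xvar) * fps_X) * B"
    by (simp only: fps_compose_mult_distrib[OF z0] fps_compose_add_distrib fps_compose_1
        fps_X_fps_compose_startby0[OF z0] B)
  also have "fps_const (- 4 * xvar) = - 4 * x"
    unfolding x_def numeral_fps_const fps_const_neg fps_const_mult ..
  finally have S: "sqrt_series = (1 - 4 * x * t) * B"
    by (simp add: t_def)
  \<comment> \<open>Coefficients are compared below with each scalar packed into one
    \<open>fps_const\<close>; these equations unpack the results.\<close>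
  have const_eqs: "fps_const (1 - xvar) = 1 - x" "fps_const (1 - 2 * xvar) = 1 - 2 * x"
    "fps_const (2 * (1 - xvar)) = 2 * (1 - x)" "fps_const (2 * xvar * (1 - xvar)) = 2 * x * (1 - x)"
    "fps_const (xvar * (1 - 2 * xvar)) = x * (1 - 2 * x)" "fps_const (2 * xvar) = 2 * x"
    "fps_const (4 * xvar) = 4 * x" "fps_const (2 :: rat poly fract) = 2"
    by (simp_all add: x_def numeral_fps_const flip: fps_const_1_eq_1)
  \<comment> \<open>The differential equation of \<open>(1 - 4xt)^(-1/2)\<close>, coefficientwise
    the recurrence of the central binomials.\<close>
  have dB: "(1 - 4 * x * t) * fps_deriv B = 2 * x * B"
  proof -
    have "fps_deriv B - fps_const (4 * xvar) * (fps_X * fps_deriv B) = fps_const (2 * xvar) * B"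
    proof (rule fps_ext)
      fix n
      have "of_nat (Suc n * ((2 * Suc n) choose (Suc n))) =
          (of_nat (2 * (2 * n + 1) * ((2 * n) choose n)) :: rat poly fract)"
        by (simp only: central_binomial_Suc)
      hence c: "(1 + of_nat n) * of_nat ((2 * Suc n) choose (Suc n)) =
          (2 * (2 * of_nat n + 1) * of_nat ((2 * n) choose n) :: rat poly fract)"
        by (simp only: of_nat_mult of_nat_Suc of_nat_add of_nat_numeral of_nat_1)
      have "fps_nth (fps_deriv B) n = (1 + of_nat n) * of_nat ((2 * Suc n) choose (Suc n)) * xvar ^ Suc n"
        by (simp add: B_def del: binomial_Suc_Suc)
      moreover have "fps_nth (fps_X * fps_deriv B) n = of_nat n * of_nat ((2 * n) choose n) * xvar ^ n"
        by (cases n) (simp_all add: B_def del: binomial_Suc_Suc)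
      ultimately show "fps_nth (fps_deriv B - fps_const (4 * xvar) * (fps_X * fps_deriv B)) n
          = fps_nth (fps_const (2 * xvar) * B) n"
        unfolding fps_sub_nth fps_mult_left_const_nth c by (simp add: B_def algebra_simps)
    qed
    thus ?thesis
      unfolding const_eqs t_def[symmetric] by (simp add: algebra_simps)
  qed
  have F: "2 * (1 - x - t) * F = 1 + (1 - 2 * x) * B"
  proof -
    have "fps_const (2 * (1 - xvar)) * F - fps_const 2 * (fps_X * F) = 1 + fps_const (1 - 2 * xvar) * B"
    proof (rule fps_ext)
      fix n
      show "fps_nth (fps_const (2 * (1 - xvar)) * F - fps_const 2 * (fps_X * F)) n
          = fps_nth (1 + fps_const (1 - 2 * xvar) * B) n"
      proof (cases n)
        case 0
        thus ?thesis by (simp add: F_def B_def polyQ_neg_0)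
      next
        case (Suc m)
        have "2 * (1 - xvar) * polyQ_neg (Suc m) - 2 * polyQ_neg m =
            (1 - 2 * xvar) * (of_nat ((2 * Suc m) choose (Suc m)) * xvar ^ Suc m)"
          unfolding mult.assoc polyQ_neg_Suc by (simp add: algebra_simps del: binomial_Suc_Suc)
        thus ?thesis by (simp add: F_def B_def Suc del: binomial_Suc_Suc)
      qed
    qed
    thus ?thesis
      unfolding const_eqs t_def[symmetric] by (simp add: algebra_simps)
  qed
  have dF: "2 * (1 - x - t) * fps_deriv F - 2 * F = (1 - 2 * x) * fps_deriv B"
  proof -
    have "fps_deriv (2 * (1 - x - t) * F) = fps_deriv (1 + (1 - 2 * x) * B)" by (simp only: F)
    thus ?thesis by (simp add: x_def t_def algebra_simps)
  qed
  \<comment> \<open>The factor \<open>of_nat n\<close> in \<open>ratV_eq\<close> becomes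
    \<open>t\<close> times the derivative. At \<open>n = 0\<close> the right side of
    \<open>ratV_eq\<close> equals \<open>1 - xvar\<close>, whereas \<open>W\<close> has constant
    term 0; hence \<open>1 + W\<close>.\<close>
  have W: "(1 - x) * (1 + W) = (F + t * fps_deriv F) - 2 * x * (1 - x) * (F + 2 * t * fps_deriv F)
     + x * (1 - 2 * x) * (B + 2 * t * fps_deriv B)"
  proof -
    let ?D = "\<lambda>f. fps_X * fps_deriv f"
    have "fps_const (1 - xvar) * (1 + W) = (F + ?D F)
        - fps_const (2 * xvar * (1 - xvar)) * (F + fps_const 2 * ?D F)
        + fps_const (xvar * (1 - 2 * xvar)) * (B + fps_const 2 * ?D B)"
      (is "?l = ?r")
    proof (rule fps_ext)
      fix n
      have D: "fps_nth (?D f) n = of_nat n * fps_nth f n" for f :: "rat poly fract fps"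
        by (cases n) simp_all
      show "fps_nth ?l n = fps_nth ?r n"
      proof (cases "n = 0")
        case True
        thus ?thesis by (simp add: W_def F_def B_def polyQ_neg_0 algebra_simps)
      next
        case False
        hence "fps_nth ?l n = (1 - xvar) * ratV n" by (simp add: W_def)
        also have "\<dots> = fps_nth ?r n"
          unfolding fps_add_nth fps_sub_nth fps_mult_left_const_nth D
          using False by (subst ratV_eq) (simp_all add: F_def B_def algebra_simps)
        finally show ?thesis .
      qed
    qed
    thus ?thesis
      unfolding const_eqs t_def[symmetric] by (simp only: mult.assoc)
  qed
  define u where "u = 1 - 4 * x * t"
  define d where "d = 1 - x - t"
  define c where "c = 1 - 2 * x"
  note eqs = dB[folded u_def] F[folded d_def c_def] dF[folded d_def c_def] W[folded c_def]
  \<comment> \<open>The factor \<open>2 * d\<^sup>2\<close> expresses the derivative of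
    \<open>F\<close> through \<open>B\<close> and its derivative, and \<open>u\<close> then removes
    the derivative of \<open>B\<close>.\<close>
  have G: "u * (2 * d\<^sup>2 * fps_deriv F) = u * (1 + c * B) + d * c * (2 * x * B)"
  proof -
    have "u * (2 * d\<^sup>2 * fps_deriv F) = u * (2 * d * F) + d * u * (2 * d * fps_deriv F - 2 * F)"
      by (simp add: algebra_simps power2_eq_square)
    also have "\<dots> = u * (2 * d * F) + d * c * (u * fps_deriv B)"
      unfolding eqs(2,3) by (simp add: algebra_simps)
    finally show ?thesis unfolding eqs .
  qed
  have "u * (1 - x) * (2 * d\<^sup>2 * (1 + W)) = 2 * d\<^sup>2 * u * ((1 - x) * (1 + W))"
    by (simp add: mult_ac)
  also have "\<dots> = (1 - 2 * x * (1 - x)) * d * u * (2 * d * F)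
      + (1 - 4 * x * (1 - x)) * t * (u * (2 * d\<^sup>2 * fps_deriv F))
      + 2 * x * c * d\<^sup>2 * (u * B + 2 * t * (u * fps_deriv B))"
    unfolding eqs(4) by (simp add: algebra_simps power2_eq_square)
  \<comment> \<open>Only \<open>x\<close>, \<open>t\<close> and \<open>B\<close> remain, so this is
    a polynomial identity. The common factor \<open>u * (1 - x)\<close> is cancelled next, since
    both factors have nonzero constant term.\<close>
  also have "\<dots> = u * (1 - x) * (1 - 2 * x + 2 * x\<^sup>2 - 2 * x * t + c * (u * B))"
    unfolding G eqs unfolding u_def d_def c_def
    by (simp add: algebra_simps power2_eq_square)
  finally have "u * (1 - x) * (2 * d\<^sup>2 * (1 + W)) =
      u * (1 - x) * (1 - 2 * x + 2 * x\<^sup>2 - 2 * x * t + c * (u * B))" .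
  moreover have "u \<noteq> 0"
  proof
    assume "u = 0"
    hence "fps_nth u 0 = 0" by simp
    thus False by (simp add: u_def t_def)
  qed
  moreover have "1 - x \<noteq> 0"
  proof
    assume "1 - x = 0"
    hence "fps_nth (1 - x) 0 = 0" by simp
    thus False using xvar_neq by (simp add: x_def)
  qed
  ultimately have "2 * d\<^sup>2 * (1 + W) = 1 - 2 * x + 2 * x\<^sup>2 - 2 * x * t + c * (u * B)"
    by simp
  \<comment> \<open>Here \<open>t + x - 1\<close> is \<open>- d\<close>, and the summand 1 in
    \<open>1 + W\<close> moves \<open>2 * d\<^sup>2\<close> to the right side.\<close>
  hence "W * (2 * (t + x - 1)\<^sup>2) =
      - 2 * t\<^sup>2 + 2 * (2 - 3 * x) * t - 1 + 2 * x + (1 - 2 * x) * sqrt_series"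
    unfolding S u_def[symmetric] by (simp add: c_def d_def algebra_simps power2_eq_square)
  moreover have "2 * (t + x - 1)\<^sup>2 \<noteq> 0"
  proof
    assume "2 * (t + x - 1)\<^sup>2 = 0"
    hence "fps_nth (t + x - 1) 0 = 0" by simp
    thus False using xvar_neq by (simp add: x_def t_def)
  qed
  ultimately show ?thesis
    unfolding W_def[symmetric] x_def[symmetric] t_def[symmetric]
    by (metis nonzero_mult_div_cancel_right)
qed

end
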